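(* Let $n,k,q$ be integers with $1 \leq k \leq \lfloor n/2 \rfloor - 1$ and $1 \leq q \leq n-1$. Let $f(n,k,q)$ denote the maximal number of edges in an $I_{k+1}$-free convex geometric graph on $n$ vertices that admits a free boundary arc of order $q$. Then: (1) If $q \leq n-2k$, then $f(n,k,q) = kn$; in particular, there exists an $I_{k+1}$-free convex geometric graph on $n$ vertices with exactly $kn$ edges that admits a free boundary arc of order $q$. (2) If $q = n-2k+\ell$ with $0 < \ell < k$, then $f(n,k,q) = kn - \binom{\ell+1}{2}$. (3) If $q \geq n-k$, then $f(n,k,q) = \binom{n}{2} - \binom{q}{2}$.
   Context: A geometric graph is a graph whose vertices are points in general position in the plane and whose edges are straight segments joining pairs of vertices. It is a convex geometric graph (CGG) if its vertices are in convex position (no vertex lies in the convex hull of the others). A geometric graph is $I_{k+1}$-free if it does not contain $k+1$ pairwise disjoint edges (edges as closed segments, so disjoint edges share no point, in particular no endpoint). For a CGG $G$, a set $A \subset V(G)$ is a free boundary arc of order $q$ if $A$ consists of $q$ consecutive vertices on the boundary of $\mathrm{conv}(V(G))$ and $A$ is independent, i.e., no edge of $G$ joins two vertices of $A$. *)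

theory Defs
  imports "HOL-Analysis.Analysis"
begin

type_synonym point = "real^2"

definition general_position :: "point set \<Rightarrow> bool" where
  "general_position V \<longleftrightarrow> (\<forall>T\<subseteq>V. card T = 3 \<longrightarrow> \<not> collinear T)"

definition convex_position :: "point set \<Rightarrow> bool" where
  "convex_position V \<longleftrightarrow> (\<forall>v\<in>V. v \<notin> convex hull (V - {v}))"

text \<open>An edge is the set of its two endpoints; the closed segment it stands for is its convex hull.\<close>

definition geometric_graph :: "point set \<Rightarrow> point set set \<Rightarrow> bool" where
  "geometric_graph V E \<longleftrightarrow> finite V \<and> general_position V \<and> E \<subseteq> {e. e \<subseteq> V \<and> card e = 2}"

definition convex_geometric_graph :: "point set \<Rightarrow> point set set \<Rightarrow> bool" where
  "convex_geometric_graph V E \<longleftrightarrow> geometric_graph V E \<and> convex_position V"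

definition disjoint_edges_free :: "nat \<Rightarrow> point set set \<Rightarrow> bool" where
  "disjoint_edges_free m E \<longleftrightarrow>
     \<not> (\<exists>M\<subseteq>E. finite M \<and> card M = m \<and>
          pairwise (\<lambda>e e'. convex hull e \<inter> convex hull e' = {}) M)"

text \<open>For at least three points in convex position, the segment joining two of them lies in the
  frontier of the hull iff it is a side of the convex polygon. Hence \<open>v\<close> below lists the vertices in
  one of the two cyclic orders around the boundary, from an arbitrary starting vertex.\<close>

definition boundary_enumeration :: "point set \<Rightarrow> (nat \<Rightarrow> point) \<Rightarrow> bool" where
  "boundary_enumeration V v \<longleftrightarrow>
     bij_betw v {..<card V} V \<and>
     (\<forall>i<card V. closed_segment (v i) (v (Suc i mod card V)) \<subseteq> frontier (convex hull V))"

definition free_boundary_arc :: "point set \<Rightarrow> point set set \<Rightarrow> nat \<Rightarrow> point set \<Rightarrow> bool" where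
  "free_boundary_arc V E q A \<longleftrightarrow>
     q \<le> card V \<and> (\<exists>v. boundary_enumeration V v \<and> A = v ` {..<q}) \<and>
     (\<forall>x\<in>A. \<forall>y\<in>A. {x, y} \<notin> E)"

definition admissible :: "nat \<Rightarrow> nat \<Rightarrow> nat \<Rightarrow> point set \<Rightarrow> point set set \<Rightarrow> bool" where
  "admissible n k q V E \<longleftrightarrow>
     convex_geometric_graph V E \<and> card V = n \<and> disjoint_edges_free (k + 1) E \<and>
     (\<exists>A. free_boundary_arc V E q A)"

definition max_edges :: "nat \<Rightarrow> nat \<Rightarrow> nat \<Rightarrow> nat" where
  "max_edges n k q = Max {card E | V E. admissible n k q V E}"

end

theory Submission
  imports Defs
begin

text \<open>
  Upper bounds: number the vertices \<open>0, \<dots>, n - 1\<close> along the boundary, the free arc being the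
  first \<open>q\<close> of them. The chords \<open>{i, j}\<close> with \<open>i + j\<close> in a fixed residue class modulo \<open>n\<close> are
  pairwise disjoint, so each of the \<open>n\<close> classes contributes at most \<open>k\<close> edges. Every edge has an end
  among the \<open>n - q\<close> vertices outside the arc; in a class that pairs many of these vertices with one
  another this leaves fewer than \<open>k\<close> edges, and the deficits add up to \<open>l + 1 choose 2\<close>.

  Lower bounds: on a parabola take the chords meeting the last \<open>k\<close> vertices and
  the chords \<open>{i, j}\<close> with \<open>j - i \<ge> n - 2 * k\<close>, and drop those inside the arc. A set of disjoint
  edges that all meet these \<open>k\<close> vertices has at most \<open>k\<close> members; otherwise all its members live on
  the at most \<open>2 * k + 1\<close> vertices on one side of one of its long chords.
\<close>

subsection \<open>Chords of a convex polygon\<close>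

text \<open>Twice the signed area of the triangle \<open>a b c\<close>.\<close>

definition orient :: "point \<Rightarrow> point \<Rightarrow> point \<Rightarrow> real" where
  "orient a b c = (b$1 - a$1) * (c$2 - a$2) - (b$2 - a$2) * (c$1 - a$1)"

lemma orient_cycle: "orient b c a = orient a b c"
  by (simp add: orient_def algebra_simps)

lemma inner_2: "inner (x :: point) y = x$1 * y$1 + x$2 * y$2"
  by (simp add: inner_vec_def sum_2)

lemma point_eq_iff: "x = y \<longleftrightarrow> x$1 = y$1 \<and> x$2 = y$2" for x y :: point
  by (simp add: vec_eq_iff forall_2)

lemma collinear_iff_orient_eq_0: "collinear {a, b, c} \<longleftrightarrow> orient a b c = 0"
proof
  assume "collinear {a, b, c}"
  then obtain u where u: "\<forall>x\<in>{a,b,c}. \<forall>y\<in>{a,b,c}. \<exists>r. x - y = r *\<^sub>R u"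
    unfolding collinear_def by blast
  then obtain r s where "b - a = r *\<^sub>R u" "c - a = s *\<^sub>R u" by blast
  then have "b$1 - a$1 = r * u$1" "b$2 - a$2 = r * u$2" "c$1 - a$1 = s * u$1" "c$2 - a$2 = s * u$2"
    by (auto simp: point_eq_iff)
  then show "orient a b c = 0" by (simp add: orient_def)
next
  assume o: "orient a b c = 0"
  show "collinear {a, b, c}"
  proof (cases "a = b")
    case True
    then show ?thesis by simp
  next
    case False
    define d where "d = b - a"
    have d: "inner d d \<noteq> 0" using False by (simp add: d_def)
    \<comment> \<open>The difference of the two sides is \<open>orient a b c\<close> times
      \<open>d\<close> rotated by a right angle.\<close>
    have "inner d d *\<^sub>R (c - a) = inner d (c - a) *\<^sub>R d"
      using o unfolding point_eq_iff orient_def inner_2 d_def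
      by (simp add: algebra_simps) algebra
    then have "c - a = (inner d (c - a) / inner d d) *\<^sub>R d"
      using d by (metis divide_inverse_commute left_inverse scaleR_one scaleR_scaleR)
    then have "collinear {0, d, c - a}"
      unfolding collinear_lemma by blast
    then have "collinear {b, a, c}"
      by (subst collinear_3) (simp_all add: NO_MATCH_def d_def)
    then show ?thesis by (simp add: insert_commute)
  qed
qed

lemma orient_affine:
  assumes "u + w = 1"
  shows "orient a b (u *\<^sub>R x + w *\<^sub>R y) = u * orient a b x + w * orient a b y"
proof -
  have w: "w = 1 - u" using assms by simp
  show ?thesis unfolding w orient_def by (simp add: algebra_simps)
qed

text \<open>\<open>orient a b\<close> is affine in its last argument and vanishes on the first
  segment, while \<open>s\<close> times it stays positive on the second. Only the sign of
  \<open>s\<close> matters; it selects the side of the line.\<close>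

lemma same_side_segments_disjoint:
  assumes "s * orient a b c > 0" "s * orient a b d > 0"
  shows "convex hull {a, b} \<inter> convex hull {c, d} = {}"
proof -
  have "convex hull {a, b} \<subseteq> {x. orient a b x = 0}"
    unfolding convex_hull_2 by (auto simp: orient_affine) (simp_all add: orient_def)
  moreover have "s * orient a b x > 0" if x: "x \<in> convex hull {c, d}" for x
  proof -
    obtain u w where x: "x = u *\<^sub>R c + w *\<^sub>R d" and uw: "0 \<le> u" "0 \<le> w" "u + w = 1"
      using x unfolding convex_hull_2 by auto
    have "s * orient a b x = u * (s * orient a b c) + w * (s * orient a b d)"
      unfolding x orient_affine[OF uw(3)] by (simp add: algebra_simps)
    moreover have "0 < u \<or> 0 < w" using uw by linarith
    ultimately show ?thesis using uw assms
      by (metis add_nonneg_pos add_pos_nonneg mult_nonneg_nonneg mult_pos_pos less_imp_le)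
  qed
  ultimately show ?thesis by fastforce
qed

text \<open>A supporting line at the midpoint of the segment must be the line through
  \<open>a\<close> and \<open>b\<close>, so all of \<open>V\<close> lies weakly on one side of it;
  general position makes this strict.\<close>

lemma orient_sign_of_frontier_segment:
  assumes gp: "general_position V"
    and ab: "a \<in> V" "b \<in> V" "a \<noteq> b"
    and fr: "closed_segment a b \<subseteq> frontier (convex hull V)"
  obtains s where "\<And>x. x \<in> V - {a, b} \<Longrightarrow> s * orient a b x > 0"
proof -
  let ?K = "convex hull V" and ?m = "midpoint a b"
  have m: "?m \<in> frontier ?K" using fr by auto
  have mK: "?m \<in> ?K"
    using ab midpoint_in_closed_segment closed_segment_subset[OF _ _ convex_convex_hull] hull_inc
    by (metis subsetD)
  have mi: "?m \<notin> interior ?K" using m by (auto simp: frontier_def)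
  obtain h where h: "h \<noteq> 0" "\<And>x. x \<in> ?K \<Longrightarrow> inner h ?m \<le> inner h x"
  proof (cases "interior ?K = {}")
    case True
    then obtain h c where "h \<noteq> 0" "\<And>x. x \<in> ?K \<Longrightarrow> inner h x = c"
      using empty_interior_subset_hyperplane[OF convex_convex_hull] by (metis (mono_tags) mem_Collect_eq subsetD)
    then show thesis using mK by (intro that[of h]) simp_all
  next
    case False
    then have "?m \<notin> rel_interior ?K" using mi rel_interior_nonempty_interior by blast
    then show thesis
      by (rule supporting_hyperplane_rel_boundary[OF convex_convex_hull mK]) (rule that)
  qed
  have hV: "inner h ?m \<le> inner h x" if "x \<in> V" for x using h(2)[OF hull_inc[OF that]] .
  \<comment> \<open>The value at the midpoint is the minimum and also the mean of the values at
    \<open>a\<close> and \<open>b\<close>, so all three agree.\<close>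
  have "inner h ?m = (inner h a + inner h b) / 2"
    by (simp add: midpoint_def inner_add_right)
  then have eq: "inner h a = inner h ?m" "inner h b = inner h ?m" using hV[OF ab(1)] hV[OF ab(2)] by auto
  define d where "d = b - a"
  \<comment> \<open>The inner product of \<open>h\<close> with \<open>d\<close> rotated by a right
    angle. Since \<open>h\<close> is orthogonal to \<open>d\<close>, this number relates
    \<open>orient a b\<close> to the functional \<open>inner h\<close>.\<close>
  define s where "s = h$2 * d$1 - h$1 * d$2"
  have hd: "h$1 * d$1 + h$2 * d$2 = 0" using eq by (simp add: d_def inner_2 algebra_simps)
  have dd: "d$1 * d$1 + d$2 * d$2 > 0"
    using ab(3) inner_gt_zero_iff[of d] unfolding inner_2 by (simp add: d_def)
  have id: "s * orient a b x = (d$1 * d$1 + d$2 * d$2) * (inner h x - inner h a)" for x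
  proof -
    have "s * (d$1 * y - d$2 * z) = (d$1 * d$1 + d$2 * d$2) * (h$1 * z + h$2 * y)" for y z
      using hd unfolding s_def by algebra
    from this[of "x$2 - a$2" "x$1 - a$1"] show ?thesis
      by (simp add: orient_def d_def inner_2 algebra_simps)
  qed
  have s0: "s \<noteq> 0"
  proof
    assume "s = 0"
    then have "(d$1 * d$1 + d$2 * d$2) * (h$1) = 0" "(d$1 * d$1 + d$2 * d$2) * (h$2) = 0"
      using hd unfolding s_def by algebra+
    then show False using dd h(1) by (auto simp: point_eq_iff)
  qed
  show thesis
  proof (rule that[of s])
    fix x assume x: "x \<in> V - {a, b}"
    then have "card {a, b, x} = 3" using ab by auto
    then have "orient a b x \<noteq> 0"
      using gp x ab unfolding general_position_def collinear_iff_orient_eq_0[symmetric] by auto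
    moreover have "s * orient a b x \<ge> 0" using id hV[of x] x eq dd by simp
    ultimately show "s * orient a b x > 0" using s0 by (simp add: less_le)
  qed
qed

text \<open>Turns the condition on the sides into one on all triples: each side has the other
  vertices on one side, the sign is passed from side to side, and induction on the last index
  reaches arbitrary triples.\<close>

lemma boundary_enumeration_orient:
  assumes be: "boundary_enumeration V v" and gp: "general_position V"
    and n: "card V \<ge> 3"
  obtains s where "\<And>i j m. i < j \<Longrightarrow> j < m \<Longrightarrow> m < card V \<Longrightarrow> s * orient (v i) (v j) (v m) > 0"
proof -
  let ?n = "card V"
  have bij: "bij_betw v {..<?n} V"
    and fr: "\<And>i. i < ?n \<Longrightarrow> closed_segment (v i) (v (Suc i mod ?n)) \<subseteq> frontier (convex hull V)"
    using be by (auto simp: boundary_enumeration_def)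
  have V: "v i \<in> V" if "i < ?n" for i using bij that by (auto simp: bij_betw_def)
  have inj: "v i = v j \<longleftrightarrow> i = j" if "i < ?n" "j < ?n" for i j
    using bij that by (auto simp: bij_betw_def inj_on_def)
  have "\<exists>s. \<forall>x\<in>V - {v i, v (Suc i)}. s * orient (v i) (v (Suc i)) x > 0" if i: "Suc i < ?n" for i
  proof -
    have "closed_segment (v i) (v (Suc i)) \<subseteq> frontier (convex hull V)" using fr[of i] i by auto
    then show ?thesis
      using orient_sign_of_frontier_segment[OF gp V V, of i "Suc i"] i inj[of i "Suc i"]
      by (metis Suc_lessD n_not_Suc_n)
  qed
  then obtain r where r: "\<And>i x. Suc i < ?n \<Longrightarrow> x \<in> V - {v i, v (Suc i)}
      \<Longrightarrow> r i * orient (v i) (v (Suc i)) x > 0" by metis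
  have r': "r i * orient (v i) (v (Suc i)) (v j) > 0"
    if "Suc i < ?n" "j < ?n" "j \<noteq> i" "j \<noteq> Suc i" for i j
    using r[of i "v j"] that V inj by auto
  define s where "s = r 0"
  \<comment> \<open>Neighbouring sides share the triple \<open>i\<close>, \<open>Suc i\<close>,
    \<open>Suc (Suc i)\<close>, which forces \<open>r i\<close> and \<open>r (Suc i)\<close> to have
    the same sign.\<close>
  have s: "s * orient (v i) (v (Suc i)) (v j) > 0"
    if "Suc i < ?n" "j < ?n" "j \<noteq> i" "j \<noteq> Suc i" for i j
    using that
  proof (induction i arbitrary: j)
    case 0
    then show ?case using r' by (simp add: s_def)
  next
    case (Suc i)
    have "s * orient (v i) (v (Suc i)) (v (Suc (Suc i))) > 0" using Suc by auto
    then have "s * orient (v (Suc i)) (v (Suc (Suc i))) (v i) > 0" by (simp add: orient_cycle)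
    moreover have "r (Suc i) * orient (v (Suc i)) (v (Suc (Suc i))) (v i) > 0" using Suc.prems r' by auto
    moreover have "r (Suc i) * orient (v (Suc i)) (v (Suc (Suc i))) (v j) > 0" using Suc.prems r' by auto
    ultimately show ?case by (smt (verit) zero_less_mult_iff)
  qed
  show thesis
  proof (rule that[of s])
    fix i j m :: nat
    assume ij: "i < j" and "j < m" "m < ?n"
    from \<open>j < m\<close> have "Suc j \<le> m" by simp
    from this \<open>m < ?n\<close> show "s * orient (v i) (v j) (v m) > 0"
    proof (induction m rule: dec_induct)
      case base
      then show ?case using s[of j i] ij by (simp add: orient_cycle)
    next
      case (step m)
      show ?case
      proof (cases "j = Suc i")
        case True
        then show ?thesis using s[of i "Suc m"] step by auto
      next
        case False
        \<comment> \<open>Pluecker relation for the vectors from \<open>v i\<close>; all points lie on one side of \<open>v i, v (Suc i)\<close>.\<close>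
        let ?u = "\<lambda>x y. s * orient (v i) (v x) (v y)"
        have "?u (Suc i) m * ?u j (Suc m) = ?u (Suc i) j * ?u m (Suc m) + ?u (Suc i) (Suc m) * ?u j m"
          by (simp add: orient_def algebra_simps)
        moreover have "?u (Suc i) m > 0" "?u (Suc i) j > 0" "?u (Suc i) (Suc m) > 0"
          using s[of i] False ij step by auto
        moreover have "?u m (Suc m) > 0" using s[of m i] ij step by (simp add: orient_cycle)
        moreover have "?u j m > 0" using step by auto
        ultimately have "?u (Suc i) m * ?u j (Suc m) > 0" by (simp add: add_pos_pos)
        with \<open>?u (Suc i) m > 0\<close> show ?thesis by (rule zero_less_mult_pos[rotated])
      qed
    qed
  qed
qed

text \<open>The line of the first chord separates the indices between \<open>i\<close> and
  \<open>j\<close> from those outside. Without interleaving, both ends of the second chord fall on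
  the same side.\<close>

lemma non_crossing_chords_disjoint:
  assumes be: "boundary_enumeration V v" and gp: "general_position V"
    and i: "i < j" "j < card V" and i': "i' < j'" "j' < card V"
    and ne: "i \<noteq> i'" "i \<noteq> j'" "j \<noteq> i'" "j \<noteq> j'"
    and nc: "\<not> (i < i' \<and> i' < j \<and> j < j')" "\<not> (i' < i \<and> i < j' \<and> j' < j)"
  shows "convex hull {v i, v j} \<inter> convex hull {v i', v j'} = {}"
proof -
  have "card V \<ge> 3" using i i' ne by linarith
  from boundary_enumeration_orient[OF be gp this] obtain s
    where s: "\<And>i j m. i < j \<Longrightarrow> j < m \<Longrightarrow> m < card V \<Longrightarrow> s * orient (v i) (v j) (v m) > 0" by blast
  have outside: "s * orient (v i) (v j) (v m) > 0" if "m < card V" "m < i \<or> j < m" for m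
    using that s[of m i j] s[of i j m] i by (auto simp: orient_cycle)
  have swap: "orient (v i) (v j) (v m) = - orient (v i) (v m) (v j)" for m
    by (simp add: orient_def algebra_simps)
  have inside: "- s * orient (v i) (v j) (v m) > 0" if "i < m" "m < j" for m
    using that s[of i m j] i by (simp add: swap[of m])
  consider "(i' < i \<or> j < i') \<and> (j' < i \<or> j < j')" | "i < i' \<and> i' < j \<and> i < j' \<and> j' < j"
    using ne nc i i' by linarith
  then show ?thesis
  proof cases
    case 1
    then show ?thesis using same_side_segments_disjoint[of s] outside i' by auto
  next
    case 2
    then show ?thesis using same_side_segments_disjoint[of "-s"] inside by auto
  qed
qed

subsection \<open>Upper bounds by parallel classes\<close>

lemma eq_if_mod_eq_of_close:
  fixes a b n :: nat
  assumes "a mod n = b mod n" "a < b + n" "b < a + n"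
  shows "a = b"
proof -
  have le: "x = y" if "x \<le> y" "x mod n = y mod n" "y < x + n" for x y :: nat
  proof -
    have "n dvd y - x" using that mod_eq_dvd_iff_nat by metis
    moreover have "y - x < n" using that by linarith
    ultimately show ?thesis using that by (auto dest: nat_dvd_not_less)
  qed
  show ?thesis using le[of a b] le[of b a] assms by linarith
qed

text \<open>Boundary indices turn crossing, parallelism and the arc into inequalities and
  congruences.\<close>

definition chord_pairs :: "(nat \<Rightarrow> point) \<Rightarrow> nat \<Rightarrow> point set set \<Rightarrow> (nat \<times> nat) set" where
  "chord_pairs v n E = {(i, j). i < j \<and> j < n \<and> {v i, v j} \<in> E}"

lemma inj_on_chord:
  fixes n :: nat
  assumes "inj_on v {..<n}"
  shows "inj_on (\<lambda>(i, j). {v i, v j}) {(i, j). i < j \<and> j < n}"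
proof (rule inj_onI, clarify)
  fix i j i' j' assume ij: "i < j" "j < n" "i' < j'" "j' < n" and eq: "{v i, v j} = {v i', v j'}"
  have "v x = v y \<longleftrightarrow> x = y" if "x < n" "y < n" for x y
    using assms that by (simp add: inj_on_eq_iff)
  moreover have "i < n" "i' < n" using ij by linarith+
  ultimately show "i = i' \<and> j = j'" using ij eq by (auto simp: doubleton_eq_iff)
qed

lemma card_chord_pairs:
  assumes bij: "bij_betw v {..<n} V" and E: "E \<subseteq> {e. e \<subseteq> V \<and> card e = 2}"
  shows "card (chord_pairs v n E) = card E"
proof -
  have inj: "inj_on v {..<n}" and V: "v ` {..<n} = V" using bij by (auto simp: bij_betw_def)
  have "(\<lambda>(i, j). {v i, v j}) ` chord_pairs v n E = E"
  proof (intro set_eqI iffI)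
    fix e assume e: "e \<in> E"
    then obtain x y where xy: "e = {x, y}" "x \<noteq> y" "{x, y} \<subseteq> V"
      using E by (auto simp: card_2_iff)
    then obtain i j where "x = v i" "y = v j" "i < n" "j < n" using V by auto
    then have "(min i j, max i j) \<in> chord_pairs v n E \<and> e = {v (min i j), v (max i j)}"
      using e xy by (cases i j rule: linorder_cases) (auto simp: chord_pairs_def insert_commute)
    then show "e \<in> (\<lambda>(i, j). {v i, v j}) ` chord_pairs v n E" by force
  qed (auto simp: chord_pairs_def)
  moreover have "inj_on (\<lambda>(i, j). {v i, v j}) (chord_pairs v n E)"
    by (rule inj_on_subset[OF inj_on_chord[OF inj]]) (auto simp: chord_pairs_def)
  ultimately show ?thesis using card_image by metis
qed

text \<open>In a regular \<open>n\<close>-gon the chords of one such class would be parallel.\<close>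

definition parallel_class :: "nat \<Rightarrow> (nat \<times> nat) set \<Rightarrow> nat \<Rightarrow> (nat \<times> nat) set" where
  "parallel_class n F u = {(i, j) \<in> F. (i + j) mod n = u mod n}"

lemma parallel_class_subset: "parallel_class n F u \<subseteq> F"
  by (auto simp: parallel_class_def)

text \<open>Two pairs that share an index or interleave have index sums less than \<open>n\<close>
  apart; congruent sums would then be equal, which the order of the indices excludes.\<close>

lemma parallel_pairs_nested:
  fixes n :: nat
  assumes ij: "i < j" "j < n" "i' < j'" "j' < n" and eq: "(i + j) mod n = (i' + j') mod n"
    and ne: "(i, j) \<noteq> (i', j')"
  shows "i \<noteq> i'" "i \<noteq> j'" "j \<noteq> i'" "j \<noteq> j'"
    "\<not> (i < i' \<and> i' < j \<and> j < j')" "\<not> (i' < i \<and> i < j' \<and> j' < j)"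
proof -
  have *: "\<not> (i + j < i' + j' + n \<and> i' + j' < i + j + n \<and> i + j \<noteq> i' + j')"
    using eq_if_mod_eq_of_close[OF eq] by blast
  show "i \<noteq> i'" "i \<noteq> j'" "j \<noteq> i'" "j \<noteq> j'" using * ij ne by auto
  show "\<not> (i < i' \<and> i' < j \<and> j < j')" "\<not> (i' < i \<and> i < j' \<and> j' < j)" using * ij by linarith+
qed

lemma card_parallel_class_le:
  assumes be: "boundary_enumeration V v" and gg: "geometric_graph V E" and n: "card V = n"
    and free: "disjoint_edges_free (k + 1) E"
  shows "card (parallel_class n (chord_pairs v n E) u) \<le> k"
proof (rule ccontr)
  let ?c = "\<lambda>(i, j). {v i, v j}"
  have gp: "general_position V" using gg by (auto simp: geometric_graph_def)
  have inj: "inj_on v {..<n}" using be n by (auto simp: boundary_enumeration_def bij_betw_def)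
  assume "\<not> ?thesis"
  then have "k + 1 \<le> card (parallel_class n (chord_pairs v n E) u)" by simp
  then obtain S where S: "S \<subseteq> parallel_class n (chord_pairs v n E) u" "card S = k + 1" "finite S"
    using obtain_subset_with_card_n by metis
  have "inj_on ?c S"
    by (rule inj_on_subset[OF inj_on_chord[OF inj]]) (use S in \<open>auto simp: parallel_class_def chord_pairs_def\<close>)
  then have "card (?c ` S) = k + 1" using S by (simp add: card_image)
  moreover have "?c ` S \<subseteq> E" using S by (auto simp: parallel_class_def chord_pairs_def)
  moreover have "pairwise (\<lambda>e e'. convex hull e \<inter> convex hull e' = {}) (?c ` S)"
  proof (rule pairwiseI)
    fix e e' assume "e \<in> ?c ` S" "e' \<in> ?c ` S" "e \<noteq> e'"
    then obtain i j i' j' where e: "e = {v i, v j}" "e' = {v i', v j'}"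
      and ij: "(i, j) \<in> S" "(i', j') \<in> S" "(i, j) \<noteq> (i', j')" by auto
    have b: "i < j" "j < n" "i' < j'" "j' < n" "(i + j) mod n = (i' + j') mod n"
      using subsetD[OF S(1) ij(1)] subsetD[OF S(1) ij(2)]
      by (simp_all add: parallel_class_def chord_pairs_def)
    show "convex hull e \<inter> convex hull e' = {}"
      unfolding e by (rule non_crossing_chords_disjoint[OF be gp])
        (use b parallel_pairs_nested[OF b ij(3)] n in auto)
  qed
  ultimately show False using free S(3) unfolding disjoint_edges_free_def by blast
qed

text \<open>Count ends outside the arc. A chord with both ends there counts twice; a chord with one
  end on the arc has its other end in the second set, where it is counted again. Chords of a class
  share no ends, so these counts are bounded by the sizes of the two sets.\<close>

lemma two_card_parallel_class_le:
  assumes F: "\<And>i j. (i, j) \<in> F \<Longrightarrow> i < j \<and> j < n \<and> q \<le> j"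
  shows "2 * card (parallel_class n F u) \<le> (n - q) + card {x \<in> {q..<n}. u < q + x \<or> x + n \<le> u}"
proof -
  let ?P = "parallel_class n F u" and ?B = "{q..<n}"
  \<comment> \<open>The vertices outside the arc whose partner in the class \<open>u\<close> may lie on the arc.\<close>
  let ?Z = "{x \<in> {q..<n}. u < q + x \<or> x + n \<le> u}"
  define s where "s p = {fst p, snd p}" for p :: "nat \<times> nat"
  have "F \<subseteq> {..<n} \<times> {..<n}" using F by force
  then have "finite F" by (rule finite_subset) simp
  then have fin: "finite ?P" by (rule finite_subset[OF parallel_class_subset])
  have disj: "s p \<inter> s p' = {}" if p: "p \<in> ?P" "p' \<in> ?P" "p \<noteq> p'" for p p'
  proof -
    obtain i j i' j' where [simp]: "p = (i, j)" "p' = (i', j')" by fastforce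
    have b: "i < j" "j < n" "i' < j'" "j' < n" "(i + j) mod n = (i' + j') mod n"
      using p F by (auto simp: parallel_class_def)
    show ?thesis using parallel_pairs_nested[OF b] p(3) by (auto simp: s_def)
  qed
  have sum: "(\<Sum>p\<in>?P. card (s p \<inter> Y)) \<le> card Y" if "finite Y" for Y
  proof -
    have "(\<Sum>p\<in>?P. card (s p \<inter> Y)) = card (\<Union>p\<in>?P. s p \<inter> Y)"
    proof (rule card_UN_disjoint[symmetric])
      show "\<forall>p\<in>?P. \<forall>p'\<in>?P. p \<noteq> p' \<longrightarrow> (s p \<inter> Y) \<inter> (s p' \<inter> Y) = {}"
      proof (intro ballI impI)
        fix p p' assume "p \<in> ?P" "p' \<in> ?P" "p \<noteq> p'"
        then have "s p \<inter> s p' = {}" by (rule disj)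
        then show "(s p \<inter> Y) \<inter> (s p' \<inter> Y) = {}" by blast
      qed
    qed (simp_all add: fin that)
    also have "\<dots> \<le> card Y" by (rule card_mono) (use that in auto)
    finally show ?thesis .
  qed
  have two: "2 \<le> card (s p \<inter> ?B) + card (s p \<inter> ?Z)" if p: "p \<in> ?P" for p
  proof -
    obtain i j where pij [simp]: "p = (i, j)" by fastforce
    have b: "i < j" "j < n" "q \<le> j" "(i + j) mod n = u mod n"
      using p F by (auto simp: parallel_class_def)
    show ?thesis
    proof (cases "q \<le> i")
      case True
      then have "s p \<inter> ?B = {i, j}" using b by (auto simp: s_def)
      then show ?thesis using b by simp
    next
      case False
      \<comment> \<open>Otherwise \<open>u - j\<close> lies in \<open>{q..<n}\<close>, and the
        congruence makes it the only possible partner of \<open>j\<close>, contrary to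
        \<open>i < q\<close>.\<close>
      have "j \<in> ?Z"
      proof (rule ccontr)
        assume "j \<notin> ?Z"
        then have "q + j \<le> u" "u < j + n" using b by auto
        moreover from this have "i + j = u" using b eq_if_mod_eq_of_close[OF b(4)] by simp
        ultimately show False using False by simp
      qed
      then have "card (s p \<inter> ?B) \<noteq> 0" "card (s p \<inter> ?Z) \<noteq> 0" using b by (auto simp: s_def)
      then show ?thesis by linarith
    qed
  qed
  have "2 * card ?P \<le> (\<Sum>p\<in>?P. card (s p \<inter> ?B) + card (s p \<inter> ?Z))"
    using sum_bounded_below[of ?P 2 "\<lambda>p. card (s p \<inter> ?B) + card (s p \<inter> ?Z)"] two
    by (simp add: mult.commute)
  also have "\<dots> \<le> card ?B + card ?Z"
    using sum[of ?B] sum[of ?Z] by (simp add: sum.distrib)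
  finally show ?thesis by simp
qed

text \<open>The classes of \<open>n\<close> consecutive numbers partition \<open>F\<close>. The
  offset \<open>w\<close> lets the sum start at the first class with a deficit.\<close>

lemma sum_card_parallel_class:
  assumes "finite F" "n > 0"
  shows "(\<Sum>m<n. card (parallel_class n F (w + m))) = card F"
proof -
  have "(\<Sum>m<n. card (parallel_class n F (w + m))) = card (\<Union>m<n. parallel_class n F (w + m))"
  proof (rule card_UN_disjoint[symmetric])
    show "\<forall>m\<in>{..<n}. finite (parallel_class n F (w + m))"
      using finite_subset[OF parallel_class_subset assms(1)] by blast
    show "\<forall>m\<in>{..<n}. \<forall>m'\<in>{..<n}. m \<noteq> m' \<longrightarrow>
        parallel_class n F (w + m) \<inter> parallel_class n F (w + m') = {}"
    proof (intro ballI impI)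
      fix m m' assume m: "m \<in> {..<n}" "m' \<in> {..<n}" "m \<noteq> m'"
      then have "(w + m) mod n \<noteq> (w + m') mod n"
        by (auto dest: eq_if_mod_eq_of_close)
      then show "parallel_class n F (w + m) \<inter> parallel_class n F (w + m') = {}"
        by (auto simp: parallel_class_def)
    qed
  qed simp
  also have "(\<Union>m<n. parallel_class n F (w + m)) = F"
  proof (intro equalityI subsetI)
    fix p assume p: "p \<in> F"
    obtain i j where [simp]: "p = (i, j)" by fastforce
    \<comment> \<open>\<open>w * (n - 1)\<close> stands for \<open>- w\<close> modulo
      \<open>n\<close>.\<close>
    let ?m = "(i + j + w * (n - 1)) mod n"
    have "(w + ?m) mod n = (w + (i + j + w * (n - 1))) mod n" by (rule mod_add_right_eq)
    also have "w + (i + j + w * (n - 1)) = i + j + w * n"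
      using assms(2) by (cases n) (auto simp: algebra_simps)
    finally have "p \<in> parallel_class n F (w + ?m)" using p by (simp add: parallel_class_def)
    moreover have "?m \<in> {..<n}" using assms(2) by simp
    ultimately show "p \<in> (\<Union>m<n. parallel_class n F (w + m))" by (rule UN_I[rotated])
  qed (use parallel_class_subset in blast)
  finally show ?thesis .
qed

lemma sum_lessThan_choose: "(\<Sum>j<n. j) = n choose 2"
  by (induction n) (auto simp: numeral_2_eq_2)

lemma sum_lessThan_Suc_choose: "(\<Sum>j<n. Suc j) = (n + 1 choose 2)"
  by (induction n) (auto simp: numeral_2_eq_2)

text \<open>Pairs each term with its mirror image, in order to add up deficits that rise and then
  fall.\<close>

lemma sum_lessThan_double:
  fixes f :: "nat \<Rightarrow> nat"
  shows "(\<Sum>m<2 * l. f m) = (\<Sum>m<l. f m + f (2 * l - Suc m))"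
proof -
  have "(\<Sum>m<2 * l. f m) = (\<Sum>m<l. f m) + (\<Sum>m=l..<2 * l. f m)"
    unfolding lessThan_atLeast0 by (rule sum.atLeastLessThan_concat[symmetric]) auto
  also have "(\<Sum>m=l..<2 * l. f m) = (\<Sum>m<l. f (2 * l - Suc m))"
    by (rule sum.reindex_bij_witness[where i = "\<lambda>m. 2 * l - Suc m" and j = "\<lambda>m. 2 * l - Suc m"]) auto
  finally show ?thesis by (simp add: sum.distrib)
qed

lemma card_pairs_le_with_free_arc:
  assumes F: "\<And>i j. (i, j) \<in> F \<Longrightarrow> i < j \<and> j < n \<and> q \<le> j"
    and k: "\<And>u. card (parallel_class n F u) \<le> k"
    and n: "2 * k \<le> n" "n > 0" and l: "l \<le> k" and q: "q = n - 2 * k + l"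
  shows "card F + (l + 1 choose 2) \<le> k * n"
proof -
  have "F \<subseteq> {..<n} \<times> {..<n}" using F by force
  then have fin: "finite F" by (rule finite_subset) simp
  \<comment> \<open>The classes \<open>w, \<dots>, w + 2 * l - 2\<close> are those with axis nearly through the middle of the arc;
    the class \<open>w + m\<close> falls short of \<open>k\<close> by at least \<open>D m\<close>.\<close>
  define w where "w = q + n - l"
  define D where "D m = (if m < l then (m + 2) div 2 else (2 * l - m) div 2)" for m
  have D: "card (parallel_class n F (w + m)) + D m \<le> k" if m: "m < n" for m
  proof -
    let ?Z = "{x \<in> {q..<n}. w + m < q + x \<or> x + n \<le> w + m}"
    let ?c = "card (parallel_class n F (w + m))"
    have "2 * ?c \<le> (n - q) + card ?Z" by (rule two_card_parallel_class_le) (rule F)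
    moreover have "n - q = 2 * k - l" using q n l by linarith
    ultimately have le: "2 * ?c \<le> 2 * k - l + card ?Z" by simp
    \<comment> \<open>At \<open>m = l - 1\<close> reflection in the axis of the class maps
      \<open>{q..<n}\<close> to itself and \<open>?Z\<close> is empty. Each step away from it, up to
      \<open>m = 2 * l - 1\<close>, lets at most one more vertex into \<open>?Z\<close>.\<close>
    consider "m < l" | "l \<le> m" "m < 2 * l" | "2 * l \<le> m" by linarith
    then show ?thesis
    proof cases
      case 1
      have "?Z \<subseteq> {n - l + m + 1..<n}" using 1 q n l unfolding w_def by auto
      then have "card ?Z \<le> l - m - 1" using card_mono[of "{n - l + m + 1..<n}" ?Z] 1 n l by simp
      then have "2 * ?c + (m + 1) \<le> 2 * k" using le 1 l by linarith
      then have "?c + (m + 2) div 2 \<le> k" by linarith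
      then show ?thesis using 1 by (simp add: D_def)
    next
      case 2
      have "?Z \<subseteq> {q..<q + (m - l + 1)}" using 2 q n l unfolding w_def by auto
      then have "card ?Z \<le> m - l + 1" using card_mono[of "{q..<q + (m - l + 1)}" ?Z] by simp
      then have "2 * ?c + (2 * l - m) \<le> 2 * k + 1" using le 2 l by linarith
      then have "?c + (2 * l - m) div 2 \<le> k" by linarith
      then show ?thesis using 2 by (simp add: D_def)
    next
      \<comment> \<open>Truncated subtraction gives \<open>D m = 0\<close>, so the plain bound
        \<open>k\<close> suffices.\<close>
      case 3
      then show ?thesis using k by (simp add: D_def)
    qed
  qed
  have "(l + 1 choose 2) = (\<Sum>m<l. Suc m)" by (simp only: sum_lessThan_Suc_choose)
  \<comment> \<open>The mirror terms are \<open>(m + 2) div 2\<close> and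
    \<open>(m + 1) div 2\<close>, with sum \<open>Suc m\<close>.\<close>
  also have "\<dots> = (\<Sum>m<l. D m + D (2 * l - Suc m))"
    by (rule sum.cong) (auto simp: D_def)
  also have "\<dots> = (\<Sum>m<2 * l. D m)" by (simp only: sum_lessThan_double)
  also have "\<dots> \<le> (\<Sum>m<n. D m)" by (rule sum_mono2) (use n l in auto)
  finally have "card F + (l + 1 choose 2) \<le> (\<Sum>m<n. card (parallel_class n F (w + m)) + D m)"
    using sum_card_parallel_class[OF fin n(2)] by (simp add: sum.distrib)
  also have "\<dots> \<le> (\<Sum>m<n. k)" by (rule sum_mono) (use D in auto)
  finally show ?thesis by (simp add: mult.commute)
qed

subsection \<open>Points on a parabola\<close>

text \<open>On a parabola the boundary order is the order of the indices, and the geometric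
  conditions become polynomial inequalities.\<close>

definition parabola :: "nat \<Rightarrow> point" where
  "parabola i = vector [real i, (real i)\<^sup>2]"

lemma parabola_nth [simp]: "parabola i $ 1 = real i" "parabola i $ 2 = (real i)\<^sup>2"
  by (simp_all add: parabola_def)

lemma inj_parabola: "inj parabola"
  by (rule injI) (simp add: point_eq_iff)

lemma card_parabola_image: "card (parabola ` X) = card X"
  by (rule card_image) (rule inj_on_subset[OF inj_parabola subset_UNIV])

lemma general_position_parabola: "general_position (parabola ` X)"
  unfolding general_position_def
proof (intro allI impI notI)
  fix T assume T: "T \<subseteq> parabola ` X" "card T = 3" "collinear T"
  then obtain S where S: "T = parabola ` S" by (auto simp: subset_image_iff)
  then have "card S = 3" using T(2) by (simp add: card_parabola_image)
  then obtain a b c where abc: "S = {a, b, c}" and ne: "a \<noteq> b" "a \<noteq> c" "b \<noteq> c"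
    by (auto simp: card_3_iff)
  have "orient (parabola a) (parabola b) (parabola c) =
      (real b - real a) * (real c - real a) * (real c - real b)"
    by (simp add: orient_def power2_eq_square algebra_simps)
  \<comment> \<open>The orientation is a Vandermonde product.\<close>
  also have "\<dots> \<noteq> 0" using ne by simp
  finally show False using T(3) by (simp add: S abc collinear_iff_orient_eq_0)
qed

lemma convex_position_parabola: "convex_position (parabola ` X)"
  unfolding convex_position_def
proof
  fix p assume "p \<in> parabola ` X"
  then obtain i where p: "p = parabola i" by auto
  \<comment> \<open>A normal of the tangent at \<open>p\<close>; all other points lie strictly above
    this tangent.\<close>
  let ?h = "vector [- 2 * real i, 1] :: point"
  have "inner ?h (parabola j) > - (real i)\<^sup>2" if "j \<noteq> i" for j
  proof -
    have "(real j - real i)\<^sup>2 > 0" using that by simp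
    then show ?thesis by (simp add: inner_2 power2_diff mult.commute mult.left_commute)
  qed
  then have "parabola ` X - {p} \<subseteq> {x. inner ?h x > - (real i)\<^sup>2}"
    using p by (auto simp: inj_eq[OF inj_parabola])
  then have "convex hull (parabola ` X - {p}) \<subseteq> {x. inner ?h x > - (real i)\<^sup>2}"
    by (rule hull_minimal) (rule convex_halfspace_gt)
  moreover have "inner ?h p = - (real i)\<^sup>2" by (simp add: p inner_2 power2_eq_square)
  ultimately show "p \<notin> convex hull (parabola ` X - {p})" by auto
qed

lemma supported_segment_subset_frontier:
  fixes a b h :: "'a::euclidean_space"
  assumes "a \<in> V" "b \<in> V" "h \<noteq> 0" "inner h a = c" "inner h b = c"
    and V: "\<And>x. x \<in> V \<Longrightarrow> inner h x \<ge> c"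
  shows "closed_segment a b \<subseteq> frontier (convex hull V)"
proof
  fix x assume x: "x \<in> closed_segment a b"
  have "closed_segment a b \<subseteq> {x. inner h x = c}"
    by (rule closed_segment_subset) (use assms convex_hyperplane in auto)
  then have hx: "inner h x = c" using x by auto
  have "x \<in> convex hull V"
    using x closed_segment_subset[OF hull_inc[OF assms(1)] hull_inc[OF assms(2)] convex_convex_hull] by blast
  moreover have "convex hull V \<subseteq> {x. inner h x \<ge> c}"
    by (rule hull_minimal) (use V convex_halfspace_ge in auto)
  then have "interior (convex hull V) \<subseteq> {x. inner h x > c}"
    by (metis interior_mono interior_halfspace_ge[OF assms(3)])
  then have "x \<notin> interior (convex hull V)" using hx by auto
  ultimately show "x \<in> frontier (convex hull V)"
    unfolding frontier_def using closure_subset by blast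
qed

lemma boundary_enumeration_parabola:
  assumes n: "n \<ge> 2"
  shows "boundary_enumeration (parabola ` {..<n}) parabola"
  unfolding boundary_enumeration_def card_parabola_image card_lessThan
proof (intro conjI allI impI)
  show "bij_betw parabola {..<n} (parabola ` {..<n})"
    by (rule inj_on_imp_bij_betw) (rule inj_on_subset[OF inj_parabola subset_UNIV])
next
  fix i assume i: "i < n"
  show "closed_segment (parabola i) (parabola (Suc i mod n)) \<subseteq> frontier (convex hull parabola ` {..<n})"
  proof (cases "Suc i = n")
    case True
    \<comment> \<open>The closing side joins the last point to \<open>parabola 0\<close> with slope
      \<open>i\<close>; all points lie on or below it.\<close>
    let ?h = "vector [real i, - 1] :: point"
    show ?thesis
    proof (rule supported_segment_subset_frontier[where h = ?h and c = 0])
      fix x assume "x \<in> parabola ` {..<n}"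
      then obtain j where j: "x = parabola j" "j \<le> i" using True by auto
      then have "real j * real j \<le> real i * real j" by (intro mult_right_mono) auto
      then show "inner ?h x \<ge> 0" using j by (simp add: inner_2 power2_eq_square)
    qed (use True n i in \<open>auto simp: inner_2 power2_eq_square point_eq_iff\<close>)
  next
    case False
    then have i': "Suc i < n" using i by simp
    \<comment> \<open>The side over \<open>i\<close> and \<open>i + 1\<close> has slope
      \<open>2 * i + 1\<close>. The parabola is below it only strictly between these abscissas,
      where there is no integer.\<close>
    let ?h = "vector [- (2 * real i + 1), 1] :: point"
    show ?thesis
    proof (rule supported_segment_subset_frontier[where h = ?h and c = "- (real i * (real i + 1))"])
      fix x assume "x \<in> parabola ` {..<n}"
      then obtain j where j: "x = parabola j" by auto
      have "0 \<le> (real j - real i) * (real j - (real i + 1))"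
      proof (cases "j \<le> i")
        case False
        then have "real i + 1 \<le> real j" by linarith
        then show ?thesis by (intro mult_nonneg_nonneg) auto
      qed (auto intro: mult_nonpos_nonpos)
      then show "inner ?h x \<ge> - (real i * (real i + 1))"
        by (simp add: j inner_2 power2_eq_square algebra_simps)
    qed (use i' in \<open>auto simp: inner_2 power2_eq_square point_eq_iff algebra_simps\<close>)
  qed
qed

text \<open>The lower bound argues from disjoint segments back to indices that do not
  interleave.\<close>

lemma parabola_chords_cross:
  assumes "a < b" "b < c" "c < d"
  shows "convex hull {parabola a, parabola c} \<inter> convex hull {parabola b, parabola d} \<noteq> {}"
proof -
  define A B C D where "A = real a" and "B = real b" and "C = real c" and "D = real d"
  have ord: "A < B" "B < C" "C < D" using assms by (auto simp: A_def B_def C_def D_def)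
  \<comment> \<open>The chord over \<open>x, y\<close> has slope \<open>x + y\<close>; \<open>t\<close> is the abscissa at which the two chords meet.\<close>
  define t where "t = (B * D - A * C) / (B + D - A - C)"
  have pos: "B + D - A - C > 0" using ord by simp
  have chord: "vector [t, (x + y) * t - x * y] \<in>
      convex hull {vector [x, x\<^sup>2], vector [y, y\<^sup>2] :: point}" if "x < y" "x \<le> t" "t \<le> y" for x y :: real
  proof -
    define u where "u = (t - x) / (y - x)"
    have u: "0 \<le> u" "u \<le> 1" "u * (y - x) = t - x" using that by (auto simp: u_def field_simps)
    have "vector [t, (x + y) * t - x * y] =
        (1 - u) *\<^sub>R vector [x, x\<^sup>2] + u *\<^sub>R (vector [y, y\<^sup>2] :: point)"
      unfolding point_eq_iff using u(3)
      by (simp add: power2_eq_square) algebra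
    then show ?thesis unfolding convex_hull_2 using u by force
  qed
  have "(t - A) * (B + D - A - C) = (B - A) * (D - A)" "(C - t) * (B + D - A - C) = (C - B) * (D - C)"
       "(t - B) * (B + D - A - C) = (B - A) * (C - B)" "(D - t) * (B + D - A - C) = (D - A) * (D - C)"
    using pos by (simp_all add: t_def field_simps)
  then have t: "A \<le> t" "t \<le> C" "B \<le> t" "t \<le> D"
    using ord pos by (smt (verit) mult_pos_pos zero_less_mult_pos2)+
  have "(A + C) * t - A * C = (B + D) * t - B * D"
    using pos by (simp add: t_def field_simps)
  then show ?thesis
    using chord[of A C] chord[of B D] t ord
    by (auto simp: parabola_def A_def B_def C_def D_def)
qed

subsection \<open>The extremal graphs\<close>

lemma card_le_of_disjoint_pairs:
  fixes S :: "('a \<times> 'a) set"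
  assumes X: "finite X" "\<And>i j. (i, j) \<in> S \<Longrightarrow> i \<in> X \<and> j \<in> X \<and> i \<noteq> j"
    and disj: "\<And>i j i' j'. (i, j) \<in> S \<Longrightarrow> (i', j') \<in> S \<Longrightarrow> (i, j) \<noteq> (i', j') \<Longrightarrow>
      {i, j} \<inter> {i', j'} = {}"
  shows "2 * card S \<le> card X"
proof -
  have "S \<subseteq> X \<times> X" using X(2) by auto
  then have fin: "finite S" using X(1) by (auto intro: finite_subset)
  have "2 * card S = (\<Sum>p\<in>S. card {fst p, snd p})"
    using X(2) by (simp add: card_insert_if)
  also have "\<dots> = card (\<Union>p\<in>S. {fst p, snd p})"
  proof (rule card_UN_disjoint[symmetric])
    show "\<forall>p\<in>S. \<forall>p'\<in>S. p \<noteq> p' \<longrightarrow> {fst p, snd p} \<inter> {fst p', snd p'} = {}"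
      using disj by (metis prod.collapse)
  qed (simp_all add: fin)
  also have "\<dots> \<le> card X" by (rule card_mono) (use X in auto)
  finally show ?thesis .
qed

text \<open>Take \<open>k + 1\<close> disjoint chords. If all have their larger end among the last
  \<open>k\<close> vertices, there are too few such ends. Otherwise the chord with the least larger
  end is long and leaves too few vertices for the others.\<close>

lemma disjoint_edges_free_parabola:
  assumes kn: "2 * k \<le> n"
    and F: "\<And>i j. (i, j) \<in> F \<Longrightarrow> i < j \<and> j < n \<and> (n - k \<le> j \<or> i + (n - 2 * k) \<le> j)"
  shows "disjoint_edges_free (k + 1) ((\<lambda>(i, j). {parabola i, parabola j}) ` F)"
  unfolding disjoint_edges_free_def
proof
  let ?c = "\<lambda>(i, j). {parabola i, parabola j}"
  assume "\<exists>M\<subseteq>?c ` F. finite M \<and> card M = k + 1 \<and>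
      pairwise (\<lambda>e e'. convex hull e \<inter> convex hull e' = {}) M"
  then obtain M where M: "M \<subseteq> ?c ` F" "card M = k + 1"
      "pairwise (\<lambda>e e'. convex hull e \<inter> convex hull e' = {}) M" by blast
  have injF: "inj_on ?c F"
    by (rule inj_on_subset[OF inj_on_chord[of parabola n]])
      (use F inj_on_subset[OF inj_parabola] in auto)
  obtain S where S: "S \<subseteq> F" "M = ?c ` S" using M(1) by (auto simp: subset_image_iff)
  have injS: "inj_on ?c S" by (rule inj_on_subset[OF injF S(1)])
  have cardS: "card S = k + 1" using M(2) S(2) card_image[OF injS] by simp
  have SF: "i < j \<and> j < n \<and> (n - k \<le> j \<or> i + (n - 2 * k) \<le> j)" if "(i, j) \<in> S" for i j
    using F S(1) that by blast
  have hulls: "convex hull {parabola i, parabola j} \<inter> convex hull {parabola i', parabola j'} = {}"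
    if "(i, j) \<in> S" "(i', j') \<in> S" "(i, j) \<noteq> (i', j')" for i j i' j'
  proof -
    have "?c (i, j) \<noteq> ?c (i', j')" using that injS by (metis inj_on_eq_iff)
    moreover have "?c (i, j) \<in> M" "?c (i', j') \<in> M" using that S(2) by blast+
    ultimately show ?thesis using M(3) unfolding pairwise_def by auto
  qed
  have disj: "{i, j} \<inter> {i', j'} = {}"
    if ij: "(i, j) \<in> S" "(i', j') \<in> S" "(i, j) \<noteq> (i', j')" for i j i' j'
  proof (rule ccontr)
    assume "{i, j} \<inter> {i', j'} \<noteq> {}"
    then obtain x where "parabola x \<in> {parabola i, parabola j}" "parabola x \<in> {parabola i', parabola j'}"
      by auto
    then show False using hulls[OF ij] hull_inc by (metis IntI empty_iff)
  qed
  have uncrossed: "\<not> (i < i' \<and> i' < j \<and> j < j')" if ij: "(i, j) \<in> S" "(i', j') \<in> S" for i j i' j'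
    using parabola_chords_cross[of i i' j j'] hulls[OF ij] by auto
  show False
  proof (cases "\<exists>i j. (i, j) \<in> S \<and> j < n - k")
    case False
    have "inj_on snd S"
    proof (rule inj_onI)
      fix p p' assume "p \<in> S" "p' \<in> S" "snd p = snd p'"
      then show "p = p'" using disj[of "fst p" "snd p" "fst p'" "snd p'"] by (cases p, cases p') auto
    qed
    moreover have "snd ` S \<subseteq> {n - k..<n}" using False SF by force
    ultimately have "card S \<le> card {n - k..<n}" by (metis card_inj_on_le finite_atLeastLessThan)
    then show False using cardS kn by simp
  next
    case True
    \<comment> \<open>All other chords of \<open>S\<close> lie beyond the chord \<open>(a, b)\<close>, where few vertices are left.\<close>
    then obtain b where b: "\<exists>i. (i, b) \<in> S" "b < n - k"
      and min: "\<And>i j. (i, j) \<in> S \<Longrightarrow> j < n - k \<Longrightarrow> b \<le> j"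
      using exists_least_iff[of "\<lambda>j. (\<exists>i. (i, j) \<in> S) \<and> j < n - k"] by (metis leI)
    then obtain a where a: "(a, b) \<in> S" by blast
    let ?X = "{..a} \<union> {b..<n}"
    have "i \<in> ?X \<and> j \<in> ?X \<and> i \<noteq> j" if ij: "(i, j) \<in> S" for i j
    proof (cases "(i, j) = (a, b)")
      case True
      then show ?thesis using SF[OF a] by auto
    next
      case False
      have "b \<le> j" using min[OF ij] b(2) by linarith
      moreover have "{a, b} \<inter> {i, j} = {}" using disj[OF a ij] False by auto
      \<comment> \<open>Here \<open>j > b\<close>, so an \<open>i\<close> strictly between
        \<open>a\<close> and \<open>b\<close> would make the chords cross.\<close>
      ultimately show ?thesis using uncrossed[OF a ij] SF[OF ij] by force
    qed
    then have "2 * card S \<le> card ?X" using card_le_of_disjoint_pairs[of ?X S] disj by blast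
    also have "\<dots> \<le> (a + 1) + (n - b)" using card_Un_le[of "{..a}" "{b..<n}"] by simp
    \<comment> \<open>The length \<open>b - a\<close> is at least \<open>n - 2 * k\<close>; the
      bound is one short of the \<open>2 * k + 2\<close> ends needed.\<close>
    also have "\<dots> \<le> 2 * k + 1" using SF[OF a] b(2) by linarith
    finally show False using cardS by simp
  qed
qed

section \<open>Counting index pairs by their larger member\<close>

lemma card_pairs_below:
  fixes f :: "nat \<Rightarrow> nat"
  assumes "finite A"
  shows "card {(i, j). j \<in> A \<and> i < f j} = (\<Sum>j\<in>A. f j)"
proof -
  have "{(i, j). j \<in> A \<and> i < f j} = prod.swap ` (SIGMA j:A. {..<f j})" by force
  also have "card \<dots> = card (SIGMA j:A. {..<f j})" by (rule card_image) simp
  finally show ?thesis using assms by simp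
qed

lemma card_pairs_outside_arc:
  assumes "q \<le> n"
  shows "card {(i, j). i < j \<and> j < n \<and> q \<le> (j :: nat)} = (n choose 2) - (q choose 2)"
proof -
  have "{(i, j). i < j \<and> j < n \<and> q \<le> j} = {(i, j). j \<in> {q..<n} \<and> i < j}" by auto
  then have "card {(i, j). i < j \<and> j < n \<and> q \<le> j} = (\<Sum>j=q..<n. j)"
    by (simp only: card_pairs_below[of "{q..<n}" "\<lambda>j. j"] finite_atLeastLessThan)
  moreover have "(\<Sum>j<q. j) + (\<Sum>j=q..<n. j) = (\<Sum>j<n. j)"
    unfolding lessThan_atLeast0 using assms by (intro sum.atLeastLessThan_concat) auto
  ultimately show ?thesis by (simp add: sum_lessThan_choose)
qed

text \<open>The arc is \<open>{..<q}\<close>. The pairs are the chords at the last \<open>k\<close> vertices together with the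
  long chords, minus those inside the arc.\<close>

definition extremal_pairs :: "nat \<Rightarrow> nat \<Rightarrow> nat \<Rightarrow> (nat \<times> nat) set" where
  "extremal_pairs n k q =
     {(i, j). i < j \<and> j < n \<and> q \<le> j \<and> (n - k \<le> j \<or> i + (n - 2 * k) \<le> j)}"

text \<open>The binomial restores the terms \<open>Suc m\<close> with \<open>m < l\<close> that the
  arc removes. Then the sum over the last \<open>k\<close> vertices, read backwards, complements the
  sum over the preceding \<open>k\<close>: matching terms add up to \<open>n\<close>.\<close>

lemma card_extremal_pairs:
  assumes n: "2 * k < n" and l: "l \<le> k"
  shows "card (extremal_pairs n k (n - 2 * k + l)) + (l + 1 choose 2) = k * n"
proof -
  obtain r where r: "n = r + 2 * k" "r > 0" using n less_imp_add_positive by (metis add.commute)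
  \<comment> \<open>The number of smaller ends allowed for the larger end \<open>j\<close>, with
    \<open>r\<close> the least length of a long chord.\<close>
  define f where "f j = (if r + k \<le> j then j else Suc (j - r))" for j
  have "extremal_pairs n k (n - 2 * k + l) = {(i, j). j \<in> {r + l..<r + 2 * k} \<and> i < f j}"
    unfolding extremal_pairs_def f_def using r by auto
  then have "card (extremal_pairs n k (n - 2 * k + l)) = (\<Sum>j=r + l..<r + 2 * k. f j)"
    by (simp only: card_pairs_below[of "{r + l..<r + 2 * k}" f] finite_atLeastLessThan)
  also have "\<dots> = (\<Sum>m=l..<2 * k. f (m + r))"
    using sum.shift_bounds_nat_ivl[of f l r "2 * k"] by (simp add: add.commute)
  also have "\<dots> = (\<Sum>m=l..<k. f (m + r)) + (\<Sum>m=k..<2 * k. f (m + r))"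
    by (rule sum.atLeastLessThan_concat[symmetric]) (use l in auto)
  also have "(\<Sum>m=l..<k. f (m + r)) = (\<Sum>m=l..<k. Suc m)"
    by (rule sum.cong) (auto simp: f_def)
  also have "(\<Sum>m=k..<2 * k. f (m + r)) = (\<Sum>m=k..<2 * k. m + r)"
    by (rule sum.cong) (auto simp: f_def)
  also have "\<dots> = (\<Sum>m<k. (2 * k - Suc m) + r)"
    by (rule sum.reindex_bij_witness[where i = "\<lambda>m. 2 * k - Suc m" and j = "\<lambda>m. 2 * k - Suc m"]) auto
  finally have "card (extremal_pairs n k (n - 2 * k + l)) + (\<Sum>m<l. Suc m) =
      ((\<Sum>m<l. Suc m) + (\<Sum>m=l..<k. Suc m)) + (\<Sum>m<k. (2 * k - Suc m) + r)" by simp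
  also have "(\<Sum>m<l. Suc m) + (\<Sum>m=l..<k. Suc m) = (\<Sum>m<k. Suc m)"
    unfolding lessThan_atLeast0 by (rule sum.atLeastLessThan_concat) (use l in auto)
  also have "(\<Sum>m<k. Suc m) + (\<Sum>m<k. (2 * k - Suc m) + r) = (\<Sum>m<k. n)"
    unfolding sum.distrib[symmetric] by (rule sum.cong) (auto simp: r)
  also have "\<dots> = k * n" by simp
  finally show ?thesis by (simp only: sum_lessThan_Suc_choose)
qed

section \<open>Passing between admissible graphs and sets of index pairs\<close>

lemma admissible_parabola:
  assumes kn: "2 * k \<le> n" and n: "2 \<le> n" and q: "q \<le> n"
    and F: "F \<subseteq> extremal_pairs n k q"
  shows "admissible n k q (parabola ` {..<n}) ((\<lambda>(i, j). {parabola i, parabola j}) ` F)"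
    (is "admissible n k q ?V ?E")
proof -
  have ij: "i < j \<and> j < n \<and> q \<le> j \<and> (n - k \<le> j \<or> i + (n - 2 * k) \<le> j)" if "(i, j) \<in> F" for i j
    using that F by (auto simp: extremal_pairs_def)
  have "convex_geometric_graph ?V ?E"
    unfolding convex_geometric_graph_def geometric_graph_def
    using general_position_parabola convex_position_parabola ij
    by (fastforce simp: card_insert_if inj_eq[OF inj_parabola])
  moreover have "disjoint_edges_free (k + 1) ?E"
    by (rule disjoint_edges_free_parabola[OF kn]) (use ij in auto)
  moreover have "free_boundary_arc ?V ?E q (parabola ` {..<q})"
  proof -
    have "{parabola x, parabola y} \<notin> ?E" if "x < q" "y < q" for x y
      using ij that by (fastforce simp: doubleton_eq_iff inj_eq[OF inj_parabola])
    then show ?thesis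
      unfolding free_boundary_arc_def
      using boundary_enumeration_parabola[OF n] q by (auto simp: card_parabola_image)
  qed
  ultimately show ?thesis unfolding admissible_def by (auto simp: card_parabola_image)
qed

lemma card_parabola_edges:
  assumes "F \<subseteq> {(i, j). i < j \<and> j < n}"
  shows "card ((\<lambda>(i, j). {parabola i, parabola j}) ` F) = card F"
  by (rule card_image)
    (rule inj_on_subset[OF inj_on_chord[OF inj_on_subset[OF inj_parabola subset_UNIV]] assms])

lemma admissible_extremal:
  assumes "2 * k \<le> n" "2 \<le> n" "q \<le> n"
  shows "\<exists>V E. admissible n k q V E \<and> card E = card (extremal_pairs n k q)"
proof -
  have "extremal_pairs n k q \<subseteq> {(i, j). i < j \<and> j < n}" by (auto simp: extremal_pairs_def)
  then show ?thesis using admissible_parabola[OF assms order_refl] card_parabola_edges by blast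
qed

text \<open>Removes the geometry from the upper bounds. As the arc occupies the first
  \<open>q\<close> indices, its independence says that the larger index of each edge is at least
  \<open>q\<close>.\<close>

lemma admissible_obtain_pairs:
  assumes "admissible n k q V E"
  obtains F where "card E = card F" "\<And>i j. (i, j) \<in> F \<Longrightarrow> i < j \<and> j < n \<and> q \<le> j"
    "\<And>u. card (parallel_class n F u) \<le> k"
proof -
  from assms obtain v where gg: "geometric_graph V E" and n: "card V = n"
    and free: "disjoint_edges_free (k + 1) E" and be: "boundary_enumeration V v"
    and arc: "\<forall>x\<in>v ` {..<q}. \<forall>y\<in>v ` {..<q}. {x, y} \<notin> E"
    unfolding admissible_def convex_geometric_graph_def free_boundary_arc_def by blast
  have "bij_betw v {..<n} V" using be n by (auto simp: boundary_enumeration_def)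
  moreover have "E \<subseteq> {e. e \<subseteq> V \<and> card e = 2}" using gg by (simp add: geometric_graph_def)
  ultimately have "card E = card (chord_pairs v n E)" by (rule card_chord_pairs[symmetric])
  moreover have "i < j \<and> j < n \<and> q \<le> j" if "(i, j) \<in> chord_pairs v n E" for i j
    using that arc by (force simp: chord_pairs_def)
  ultimately show thesis using card_parallel_class_le[OF be gg n free] by (rule that)
qed

lemma admissible_card_le:
  assumes "admissible n k q V E" "n > 0"
  shows "card E \<le> k * n"
proof -
  obtain F where F: "card E = card F"
    "\<And>i j. (i, j) \<in> F \<Longrightarrow> i < j \<and> j < n \<and> q \<le> j" "\<And>u. card (parallel_class n F u) \<le> k"
    by (rule admissible_obtain_pairs[OF assms(1)]) (rule that)
  have "F \<subseteq> {..<n} \<times> {..<n}" using F(2) by force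
  then have "finite F" by (rule finite_subset) simp
  then have "card F = (\<Sum>m<n. card (parallel_class n F (0 + m)))"
    by (rule sum_card_parallel_class[OF _ assms(2), symmetric])
  also have "\<dots> \<le> (\<Sum>m<n. k)" by (rule sum_mono) (rule F(3))
  finally show ?thesis using F(1) by (simp add: mult.commute)
qed

lemma admissible_card_le_arc:
  assumes "admissible n k (n - 2 * k + l) V E" "2 * k \<le> n" "n > 0" "l \<le> k"
  shows "card E \<le> k * n - (l + 1 choose 2)"
proof -
  obtain F where F: "card E = card F"
    "\<And>i j. (i, j) \<in> F \<Longrightarrow> i < j \<and> j < n \<and> n - 2 * k + l \<le> j"
    "\<And>u. card (parallel_class n F u) \<le> k"
    by (rule admissible_obtain_pairs[OF assms(1)]) (rule that)
  from card_pairs_le_with_free_arc[OF F(2,3) assms(2-4) refl] show ?thesis using F(1) by simp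
qed

lemma admissible_card_le_outside_arc:
  assumes "admissible n k q V E" "q \<le> n"
  shows "card E \<le> (n choose 2) - (q choose 2)"
proof -
  obtain F where F: "card E = card F"
    "\<And>i j. (i, j) \<in> F \<Longrightarrow> i < j \<and> j < n \<and> q \<le> j"
    "\<And>u. card (parallel_class n F u) \<le> k"
    by (rule admissible_obtain_pairs[OF assms(1)]) (rule that)
  let ?A = "{(i, j). i < j \<and> j < n \<and> q \<le> j}"
  have "?A \<subseteq> {..<n} \<times> {..<n}" by auto
  then have "finite ?A" by (rule finite_subset) simp
  then have "card F \<le> card ?A" by (rule card_mono) (use F(2) in auto)
  then show ?thesis using F(1) card_pairs_outside_arc[OF assms(2)] by simp
qed

text \<open>The upper bound also supplies the finiteness on which \<open>Max\<close>
  depends.\<close>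

lemma max_edges_eqI:
  assumes ex: "\<exists>V E. admissible n k q V E \<and> card E = m"
    and le: "\<And>V E. admissible n k q V E \<Longrightarrow> card E \<le> m"
  shows "max_edges n k q = m"
  unfolding max_edges_def
proof (rule Max_eqI)
  have "{card E |V E. admissible n k q V E} \<subseteq> {..m}" using le by auto
  then show "finite {card E |V E. admissible n k q V E}" by (rule finite_subset) simp
qed (use assms in auto)

theorem theorem1:
  fixes n k q :: nat
  assumes "1 \<le> k" and "k \<le> n div 2 - 1" and "1 \<le> q" and "q \<le> n - 1"
  shows "(q \<le> n - 2 * k \<longrightarrow>
            max_edges n k q = k * n \<and> (\<exists>V E. admissible n k q V E \<and> card E = k * n)) \<and>
         (\<forall>l. 0 < l \<and> l < k \<and> q = n - 2 * k + l \<longrightarrow>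
            max_edges n k q = k * n - (l + 1 choose 2)) \<and>
         (q \<ge> n - k \<longrightarrow> max_edges n k q = (n choose 2) - (q choose 2))"
proof -
  have n: "2 * k < n" "2 * k \<le> n" "2 \<le> n" "n > 0" "q \<le> n" using assms by auto
  note ex = admissible_extremal[OF n(2,3,5)]
  show ?thesis
  proof (intro conjI impI allI)
    assume q: "q \<le> n - 2 * k"
    \<comment> \<open>Every extremal pair has its larger index at least \<open>n - 2 * k\<close>, so
      an arc this short removes nothing.\<close>
    have "extremal_pairs n k q = extremal_pairs n k (n - 2 * k + 0)"
      using q unfolding extremal_pairs_def by auto
    then have "card (extremal_pairs n k q) = k * n"
      using card_extremal_pairs[OF n(1), of 0] by (simp add: numeral_2_eq_2)
    then show ex': "\<exists>V E. admissible n k q V E \<and> card E = k * n" using ex by simp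
    show "max_edges n k q = k * n"
      by (rule max_edges_eqI[OF ex']) (rule admissible_card_le[OF _ n(4)])
  next
    fix l assume l: "0 < l \<and> l < k \<and> q = n - 2 * k + l"
    then have "card (extremal_pairs n k q) = k * n - (l + 1 choose 2)"
      using card_extremal_pairs[OF n(1), of l] by simp
    then have "\<exists>V E. admissible n k q V E \<and> card E = k * n - (l + 1 choose 2)" using ex by simp
    then show "max_edges n k q = k * n - (l + 1 choose 2)"
      by (rule max_edges_eqI) (use admissible_card_le_arc[OF _ n(2,4)] l in auto)
  next
    assume q: "n - k \<le> q"
    \<comment> \<open>Every vertex outside the arc is among the last \<open>k\<close>, so all pairs
      not inside the arc are present.\<close>
    have "extremal_pairs n k q = {(i, j). i < j \<and> j < n \<and> q \<le> j}"
      using q unfolding extremal_pairs_def by auto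
    then have "card (extremal_pairs n k q) = (n choose 2) - (q choose 2)"
      using card_pairs_outside_arc[OF n(5)] by simp
    then have "\<exists>V E. admissible n k q V E \<and> card E = (n choose 2) - (q choose 2)" using ex by simp
    then show "max_edges n k q = (n choose 2) - (q choose 2)"
      by (rule max_edges_eqI) (rule admissible_card_le_outside_arc[OF _ n(5)])
  qed
qed

end
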